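(* Let IRL be the propositional proof system defined in the context, and let CL be classical propositional logic in the same language. Let $\mathrm{IRL}+\{\neg\phi\vee\psi\to(\phi\to\psi)\}$ be the system obtained from IRL by adding the schema $\neg\phi\vee\psi\to(\phi\to\psi)$ (Disjunction-to-Implication) as an axiom schema. Then $$\mathrm{IRL}+\{\neg\phi\vee\psi\to(\phi\to\psi)\}=\mathrm{CL},$$ i.e. the two systems are deductively equivalent.
   Context: Language: formulas are built from a countable set $K$ of primitive propositions using the connectives $\top,\bot$ (nullary), $\neg$ (unary), $\wedge,\vee,\leftrightarrow,\to$ (binary, all syntactically independent symbols). $\neg$ binds strongest, and $\wedge,\vee$ bind more strongly than $\to,\leftrightarrow$. Schematic letters $\phi,\psi,\chi$ range over all formulas. Axiom schemas of IRL: $\phi\leftrightarrow\phi$; $\phi\wedge\psi\leftrightarrow\psi\wedge\phi$; $\phi\vee\psi\leftrightarrow\psi\vee\phi$; $(\phi\wedge\psi)\wedge\chi\leftrightarrow\phi\wedge(\psi\wedge\chi)$; $(\phi\vee\psi)\vee\chi\leftrightarrow\phi\vee(\psi\vee\chi)$; $\phi\wedge(\psi\vee\chi)\leftrightarrow(\phi\wedge\psi)\vee(\phi\wedge\chi)$; $\phi\vee(\psi\wedge\chi)\leftrightarrow(\phi\vee\psi)\wedge(\phi\vee\chi)$; $\phi\wedge\top\leftrightarrow\phi$; $\phi\vee\bot\leftrightarrow\phi$; $\phi\wedge\neg\phi\leftrightarrow\bot$; $\phi\vee\neg\phi\leftrightarrow\top$; $(\phi\to\psi)\leftrightarrow(\phi\wedge\psi\leftrightarrow\phi)$.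 Primitive rules of IRL: (R1) from $\phi,\psi$ infer $\phi\wedge\psi$; (R2) from $\phi\wedge\psi$ infer $\phi$; (R3) from $\phi\leftrightarrow\psi$ and $\chi$ infer $\chi[\phi\mapsto\psi]$, where $\chi[\phi\mapsto\psi]$ is any formula obtained from $\chi$ by replacing one or more arbitrarily selected occurrences of the subformula $\phi$ by $\psi$; (R4, conditional proof) if $\{\phi\}\vdash\psi$ then $\vdash\phi\to\psi$. Derivations: for a finite set $X$ of formulas, $X\vdash y$ means there is a finite sequence of formulas ending in $y$, each member of which is a theorem or results from members of $X$ and earlier members of the sequence by R1, R2 or R3. A theorem is a formula $y$ with $\emptyset\vdash y$ (written $\vdash y$); axioms are theorems, and formulas $\phi\to\psi$ obtained by R4 are theorems. R4 applies only to derivations with the single premise $\phi$ and no other undischarged premises. A rule $X\Rightarrow y$ is derivable if $X\vdash y$. Extension: if $S$ is a system and $X$ a set of schemas, $S+X$ is $S$ with all instances of members of $X$ as additional axioms (the rules, including R4, are then applied in the extended system). Two systems $A,B$ in the same language are deductively equivalent, written $A=B$, if every axiom and primitive rule of $B$ is derivable in $A$ and vice versa. CL is classical propositional logic in this language, with the usual two-valued truth tables for all connectives (so $\phi\to\psi$ is equivalent to $\neg\phi\vee\psi$ and $\phi\leftrightarrow\psi$ to $(\phi\to\psi)\wedge(\psi\to\phi)$), given by any standard sound and complete axiomatization: $\{\phi_1,\dots,\phi_n\}\vdash_{\mathrm{CL}}\psi$ iff $\psi$ is a two-valued truth-functional consequence of $\phi_1,\dots,\phi_n$. *)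

theory Defs
  imports Main "HOL-Library.Countable"
begin

datatype (atoms: 'a) fm =
    Atom 'a
  | Top  ("\<^bold>\<top>")
  | Bot  ("\<^bold>\<bottom>")
  | Neg "'a fm"  ("\<^bold>\<not> _" [90] 90)
  | And "'a fm" "'a fm"  (infixr "\<^bold>\<and>" 80)
  | Or  "'a fm" "'a fm"  (infixr "\<^bold>\<or>" 80)
  | Iff "'a fm" "'a fm"  (infixr "\<^bold>\<longleftrightarrow>" 70)
  | Imp "'a fm" "'a fm"  (infixr "\<^bold>\<longrightarrow>" 70)

primrec subst :: "('a \<Rightarrow> 'b fm) \<Rightarrow> 'a fm \<Rightarrow> 'b fm" where
  "subst \<sigma> (Atom p) = \<sigma> p"
| "subst \<sigma> \<^bold>\<top> = \<^bold>\<top>"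
| "subst \<sigma> \<^bold>\<bottom> = \<^bold>\<bottom>"
| "subst \<sigma> (\<^bold>\<not> a) = \<^bold>\<not> (subst \<sigma> a)"
| "subst \<sigma> (a \<^bold>\<and> b) = (subst \<sigma> a) \<^bold>\<and> (subst \<sigma> b)"
| "subst \<sigma> (a \<^bold>\<or> b) = (subst \<sigma> a) \<^bold>\<or> (subst \<sigma> b)"
| "subst \<sigma> (a \<^bold>\<longleftrightarrow> b) = (subst \<sigma> a) \<^bold>\<longleftrightarrow> (subst \<sigma> b)"
| "subst \<sigma> (a \<^bold>\<longrightarrow> b) = (subst \<sigma> a) \<^bold>\<longrightarrow> (subst \<sigma> b)"


section \<open>Proof systems and derivations\<close>

text \<open>A rule is represented by the set of its instances, each a finite list of premises with a
  conclusion. The conditional proof rule acts on derivations rather than on formulas, so a system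
  only records whether it has that rule.\<close>

record 'a system =
  axioms :: "'a fm set"
  rules :: "('a fm list \<times> 'a fm) set"
  cond_proof :: bool

text \<open>The recursion through conditional proof makes theorems and derivations mutually dependent;
  a theorem is a formula derivable from the empty set. Conditional proof discharges the only premise
  of a derivation, and its result is a theorem.\<close>

inductive derivable :: "'a system \<Rightarrow> 'a fm set \<Rightarrow> 'a fm \<Rightarrow> bool"
  for S :: "'a system" where
  from_premise: "x \<in> X \<Longrightarrow> derivable S X x"
| from_axiom: "a \<in> axioms S \<Longrightarrow> derivable S {} a"
| from_thm: "derivable S {} y \<Longrightarrow> derivable S X y"
| from_rule: "(ps, c) \<in> rules S \<Longrightarrow> (\<And>p. p \<in> set ps \<Longrightarrow> derivable S X p) \<Longrightarrow> derivable S X c"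
| from_cond_proof: "cond_proof S \<Longrightarrow> derivable S {a} b \<Longrightarrow> derivable S {} (a \<^bold>\<longrightarrow> b)"

text \<open>Derivability in \<open>A\<close> of all axioms and primitive rules of \<open>B\<close>. For conditional proof this means
  that \<open>A\<close> is closed under it.\<close>

definition derives_system :: "'a system \<Rightarrow> 'a system \<Rightarrow> bool" where
  "derives_system A B \<longleftrightarrow>
     (\<forall>a \<in> axioms B. derivable A {} a) \<and>
     (\<forall>(ps, c) \<in> rules B. derivable A (set ps) c) \<and>
     (cond_proof B \<longrightarrow> (\<forall>a b. derivable A {a} b \<longrightarrow> derivable A {} (a \<^bold>\<longrightarrow> b)))"

definition deductively_equivalent :: "'a system \<Rightarrow> 'a system \<Rightarrow> bool" where
  "deductively_equivalent A B \<longleftrightarrow> derives_system A B \<and> derives_system B A"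


section \<open>Schemas\<close>

datatype letter = LPhi | LPsi | LChi

type_synonym schema = "letter fm"

definition instances :: "schema \<Rightarrow> 'a fm set" where
  "instances s = {subst \<sigma> s | \<sigma>. True}"

definition add_schemas :: "'a system \<Rightarrow> schema set \<Rightarrow> 'a system" where
  "add_schemas S X = S\<lparr>axioms := axioms S \<union> (\<Union>s\<in>X. instances s)\<rparr>"

abbreviation \<phi> :: schema where "\<phi> \<equiv> Atom LPhi"
abbreviation \<psi> :: schema where "\<psi> \<equiv> Atom LPsi"
abbreviation \<chi> :: schema where "\<chi> \<equiv> Atom LChi"


section \<open>The system IRL\<close>

definition IRL_schemas :: "schema set" where
  "IRL_schemas =
    { \<phi> \<^bold>\<longleftrightarrow> \<phi>,
      (\<phi> \<^bold>\<and> \<psi>) \<^bold>\<longleftrightarrow> (\<psi> \<^bold>\<and> \<phi>),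
      (\<phi> \<^bold>\<or> \<psi>) \<^bold>\<longleftrightarrow> (\<psi> \<^bold>\<or> \<phi>),
      ((\<phi> \<^bold>\<and> \<psi>) \<^bold>\<and> \<chi>) \<^bold>\<longleftrightarrow> (\<phi> \<^bold>\<and> (\<psi> \<^bold>\<and> \<chi>)),
      ((\<phi> \<^bold>\<or> \<psi>) \<^bold>\<or> \<chi>) \<^bold>\<longleftrightarrow> (\<phi> \<^bold>\<or> (\<psi> \<^bold>\<or> \<chi>)),
      (\<phi> \<^bold>\<and> (\<psi> \<^bold>\<or> \<chi>)) \<^bold>\<longleftrightarrow> ((\<phi> \<^bold>\<and> \<psi>) \<^bold>\<or> (\<phi> \<^bold>\<and> \<chi>)),
      (\<phi> \<^bold>\<or> (\<psi> \<^bold>\<and> \<chi>)) \<^bold>\<longleftrightarrow> ((\<phi> \<^bold>\<or> \<psi>) \<^bold>\<and> (\<phi> \<^bold>\<or> \<chi>)),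
      (\<phi> \<^bold>\<and> \<^bold>\<top>) \<^bold>\<longleftrightarrow> \<phi>,
      (\<phi> \<^bold>\<or> \<^bold>\<bottom>) \<^bold>\<longleftrightarrow> \<phi>,
      (\<phi> \<^bold>\<and> \<^bold>\<not> \<phi>) \<^bold>\<longleftrightarrow> \<^bold>\<bottom>,
      (\<phi> \<^bold>\<or> \<^bold>\<not> \<phi>) \<^bold>\<longleftrightarrow> \<^bold>\<top>,
      (\<phi> \<^bold>\<longrightarrow> \<psi>) \<^bold>\<longleftrightarrow> ((\<phi> \<^bold>\<and> \<psi>) \<^bold>\<longleftrightarrow> \<phi>) }"

text \<open>In the replacement rule, the selected occurrences are marked by the extra atom \<open>None\<close> in a
  template \<open>t\<close>: the formula \<open>plug a t\<close> has \<open>a\<close> at each of these places, and \<open>plug b t\<close> arises from it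
  by replacing exactly these occurrences of \<open>a\<close> by \<open>b\<close>.\<close>

definition plug :: "'a fm \<Rightarrow> 'a option fm \<Rightarrow> 'a fm" where
  "plug a = subst (case_option a Atom)"

definition R1 :: "('a fm list \<times> 'a fm) set" where
  "R1 = {([a, b], a \<^bold>\<and> b) | a b. True}"

definition R2 :: "('a fm list \<times> 'a fm) set" where
  "R2 = {([a \<^bold>\<and> b], a) | a b. True}"

definition R3 :: "('a fm list \<times> 'a fm) set" where
  "R3 = {([a \<^bold>\<longleftrightarrow> b, plug a t], plug b t) | a b t. None \<in> atoms t}"

definition IRL :: "'a system" where
  "IRL = \<lparr>axioms = (\<Union>s\<in>IRL_schemas. instances s), rules = R1 \<union> R2 \<union> R3, cond_proof = True\<rparr>"

definition disj_to_imp :: schema where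
  "disj_to_imp = (\<^bold>\<not> \<phi> \<^bold>\<or> \<psi>) \<^bold>\<longrightarrow> (\<phi> \<^bold>\<longrightarrow> \<psi>)"


section \<open>Classical logic\<close>

primrec eval :: "('a \<Rightarrow> bool) \<Rightarrow> 'a fm \<Rightarrow> bool" where
  "eval v (Atom p) = v p"
| "eval v \<^bold>\<top> = True"
| "eval v \<^bold>\<bottom> = False"
| "eval v (\<^bold>\<not> a) = (\<not> eval v a)"
| "eval v (a \<^bold>\<and> b) = (eval v a \<and> eval v b)"
| "eval v (a \<^bold>\<or> b) = (eval v a \<or> eval v b)"
| "eval v (a \<^bold>\<longleftrightarrow> b) = (eval v a \<longleftrightarrow> eval v b)"
| "eval v (a \<^bold>\<longrightarrow> b) = (eval v a \<longrightarrow> eval v b)"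

definition entails :: "'a fm set \<Rightarrow> 'a fm \<Rightarrow> bool" where
  "entails X y \<longleftrightarrow> (\<forall>v. (\<forall>x\<in>X. eval v x) \<longrightarrow> eval v y)"

text \<open>Classical logic may be given by any sound and complete axiomatization; this predicate
  characterizes those.\<close>

definition axiomatizes_CL :: "'a system \<Rightarrow> bool" where
  "axiomatizes_CL C \<longleftrightarrow> (\<forall>X y. finite X \<longrightarrow> (derivable C X y \<longleftrightarrow> entails X y))"

text \<open>Such systems exist: for instance, all tautologies with modus ponens.\<close>

definition taut_MP :: "'a system" where
  "taut_MP = \<lparr>axioms = {a. entails {} a}, rules = {([a, a \<^bold>\<longrightarrow> b], b) | a b. True},
     cond_proof = False\<rparr>"

lemma axiomatizes_CL_taut_MP: "axiomatizes_CL (taut_MP :: 'a system)"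
proof -
  have sound: "entails X y" if "derivable taut_MP X y" for X and y :: "'a fm"
    using that
  proof induction
    case (from_rule ps c X)
    then obtain a where "ps = [a, a \<^bold>\<longrightarrow> c]" by (auto simp: taut_MP_def)
    with from_rule.IH[of a] from_rule.IH[of "a \<^bold>\<longrightarrow> c"] show ?case
      by (simp add: entails_def)
  qed (auto simp: taut_MP_def entails_def)
  have MP: "derivable taut_MP X b" if "derivable taut_MP X a" "derivable taut_MP X (a \<^bold>\<longrightarrow> b)"
    for X and a b :: "'a fm"
  proof (rule from_rule)
    show "([a, a \<^bold>\<longrightarrow> b], b) \<in> rules taut_MP" by (simp add: taut_MP_def)
  qed (use that in auto)
  have complete: "derivable taut_MP X y"
    if "finite Y" "Y \<subseteq> X" "entails Y y" for X Y and y :: "'a fm"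
    using that
  proof (induction Y arbitrary: y rule: finite_induct)
    case empty
    then show ?case by - (rule from_thm, rule from_axiom, simp add: taut_MP_def)
  next
    case (insert x Y)
    have "entails Y (x \<^bold>\<longrightarrow> y)" using insert.prems by (auto simp: entails_def)
    then have "derivable taut_MP X (x \<^bold>\<longrightarrow> y)" using insert.IH insert.prems(1) by blast
    moreover have "derivable taut_MP X x" using insert.prems by (auto intro: from_premise)
    ultimately show ?case by (rule MP[rotated])
  qed
  show ?thesis
    unfolding axiomatizes_CL_def using sound complete[OF _ subset_refl] by blast
qed

end

theory Submission
  imports Defs
begin

text \<open>For completeness, Disjunction-to-Implication gives \<open>p \<turnstile> p \<longleftrightarrow> \<top>\<close>: the premise \<open>p\<close> is equivalent to
  \<open>\<not> \<top> \<or> p\<close>, which yields \<open>\<top> \<longrightarrow> p\<close>, that is \<open>\<top> \<and> p \<longleftrightarrow> \<top>\<close>. Hence \<open>\<not> p \<turnstile> p \<longleftrightarrow> \<bottom>\<close> as well. By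
  replacement, a formula whose instances at \<open>p = \<top>\<close> and \<open>p = \<bottom>\<close> are both theorems follows from \<open>p\<close> and
  from \<open>\<not> p\<close>, so by conditional proof and distributivity it is a theorem. This eliminates the atoms of
  a tautology one at a time, and atom-free formulas are evaluated by the truth tables.\<close>

section \<open>Atoms, substitutions and templates\<close>

lemma finite_atoms: "finite (atoms y)"
  by (induction y) auto

lemma atoms_subst: "atoms (subst \<sigma> y) = (\<Union>p\<in>atoms y. atoms (\<sigma> p))"
  by (induction y) auto

lemma eval_subst: "eval v (subst \<sigma> y) = eval (\<lambda>p. eval v (\<sigma> p)) y"
  by (induction y) auto

lemma subst_cong: "(\<And>p. p \<in> atoms y \<Longrightarrow> \<sigma> p = \<tau> p) \<Longrightarrow> subst \<sigma> y = subst \<tau> y"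
  by (induction y) auto

lemma subst_Atom: "subst Atom y = y"
  by (induction y) auto

text \<open>\<open>map_fm Some\<close> turns a formula into a template without marked places.
  Combined with \<open>Atom None\<close>, it gives templates that keep one part fixed.\<close>

lemma plug_map_Some: "plug a (map_fm Some y) = y"
  by (induction y) (auto simp: plug_def)

lemma plug_simps [simp]:
  "plug a (Atom None) = a"
  "plug a (\<^bold>\<not> t) = \<^bold>\<not> (plug a t)"
  "plug a (t \<^bold>\<and> u) = plug a t \<^bold>\<and> plug a u"
  "plug a (t \<^bold>\<or> u) = plug a t \<^bold>\<or> plug a u"
  "plug a (t \<^bold>\<longleftrightarrow> u) = plug a t \<^bold>\<longleftrightarrow> plug a u"
  "plug a (t \<^bold>\<longrightarrow> u) = plug a t \<^bold>\<longrightarrow> plug a u"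
  by (simp_all add: plug_def)

section \<open>Extensions of IRL\<close>

text \<open>Axioms and rules are bounded only from below, so all results here apply to IRL with an
  added schema.\<close>

locale IRL_extension =
  fixes S :: "'a system"
  assumes axioms_IRL: "axioms IRL \<subseteq> axioms S"
    and rules_IRL: "rules IRL \<subseteq> rules S"
    and cond_proof: "cond_proof S"
begin

abbreviation proves :: "'a fm set \<Rightarrow> 'a fm \<Rightarrow> bool"  (infix "\<turnstile>" 50) where
  "X \<turnstile> y \<equiv> derivable S X y"

lemma IRL_schemas: "\<forall>s\<in>IRL_schemas. X \<turnstile> subst \<sigma> s"
proof
  fix s
  assume "s \<in> IRL_schemas"
  then have "subst \<sigma> s \<in> axioms S"
    using axioms_IRL by (auto simp: IRL_def instances_def)
  then show "X \<turnstile> subst \<sigma> s" by (rule from_thm[OF from_axiom])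
qed

lemma IRL_axioms:
  "X \<turnstile> a \<^bold>\<longleftrightarrow> a"
  "X \<turnstile> (a \<^bold>\<and> b) \<^bold>\<longleftrightarrow> (b \<^bold>\<and> a)"
  "X \<turnstile> (a \<^bold>\<or> b) \<^bold>\<longleftrightarrow> (b \<^bold>\<or> a)"
  "X \<turnstile> ((a \<^bold>\<and> b) \<^bold>\<and> c) \<^bold>\<longleftrightarrow> (a \<^bold>\<and> (b \<^bold>\<and> c))"
  "X \<turnstile> (a \<^bold>\<and> (b \<^bold>\<or> c)) \<^bold>\<longleftrightarrow> ((a \<^bold>\<and> b) \<^bold>\<or> (a \<^bold>\<and> c))"
  "X \<turnstile> (a \<^bold>\<or> (b \<^bold>\<and> c)) \<^bold>\<longleftrightarrow> ((a \<^bold>\<or> b) \<^bold>\<and> (a \<^bold>\<or> c))"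
  "X \<turnstile> (a \<^bold>\<and> \<^bold>\<top>) \<^bold>\<longleftrightarrow> a"
  "X \<turnstile> (a \<^bold>\<or> \<^bold>\<bottom>) \<^bold>\<longleftrightarrow> a"
  "X \<turnstile> (a \<^bold>\<and> \<^bold>\<not> a) \<^bold>\<longleftrightarrow> \<^bold>\<bottom>"
  "X \<turnstile> (a \<^bold>\<or> \<^bold>\<not> a) \<^bold>\<longleftrightarrow> \<^bold>\<top>"
  "X \<turnstile> (a \<^bold>\<longrightarrow> b) \<^bold>\<longleftrightarrow> ((a \<^bold>\<and> b) \<^bold>\<longleftrightarrow> a)"
  using IRL_schemas[of X "case_letter a b c"] unfolding IRL_schemas_def by simp_all

lemmas iff_refl = IRL_axioms(1)
  and and_comm = IRL_axioms(2)
  and or_comm = IRL_axioms(3)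
  and and_assoc = IRL_axioms(4)
  and and_or_distrib = IRL_axioms(5)
  and or_and_distrib = IRL_axioms(6)
  and and_top = IRL_axioms(7)
  and or_bot = IRL_axioms(8)
  and and_neg = IRL_axioms(9)
  and or_neg = IRL_axioms(10)
  and imp_iff = IRL_axioms(11)

lemma and_left: "X \<turnstile> a \<^bold>\<and> b \<Longrightarrow> X \<turnstile> a"
  by (rule from_rule[of "[a \<^bold>\<and> b]" a]) (use rules_IRL in \<open>auto simp: IRL_def R2_def\<close>)

lemma replace:
  assumes "X \<turnstile> a \<^bold>\<longleftrightarrow> b" "X \<turnstile> plug a t" "None \<in> atoms t"
  shows "X \<turnstile> plug b t"
proof (rule from_rule)
  show "([a \<^bold>\<longleftrightarrow> b, plug a t], plug b t) \<in> rules S"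
    using rules_IRL assms(3) by (force simp: IRL_def R3_def)
qed (use assms in auto)

section \<open>Equivalence as a congruence\<close>

lemma iff_mp: "X \<turnstile> a \<^bold>\<longleftrightarrow> b \<Longrightarrow> X \<turnstile> a \<Longrightarrow> X \<turnstile> b"
  using replace[of X a b "Atom None"] by simp

text \<open>Replacement becomes congruence when it acts only on the right-hand copy in an instance
  of reflexivity.\<close>

lemma plug_iff:
  assumes "X \<turnstile> a \<^bold>\<longleftrightarrow> b"
  shows "X \<turnstile> plug a t \<^bold>\<longleftrightarrow> plug b t"
proof (cases "None \<in> atoms t")
  case True
  then show ?thesis
    using replace[OF assms, of "map_fm Some (plug a t) \<^bold>\<longleftrightarrow> t"]
    by (simp add: plug_map_Some iff_refl)
next
  \<comment> \<open>R3 demands at least one marked place; without any, both sides coincide.\<close>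
  case False
  then have "plug a t = plug b t"
    unfolding plug_def by (intro subst_cong) (auto split: option.split)
  then show ?thesis by (simp add: iff_refl)
qed

lemma iff_sym: "X \<turnstile> a \<^bold>\<longleftrightarrow> b \<Longrightarrow> X \<turnstile> b \<^bold>\<longleftrightarrow> a"
  using replace[of X a b "Atom None \<^bold>\<longleftrightarrow> map_fm Some a"] by (simp add: plug_map_Some iff_refl)

lemma iff_trans: "X \<turnstile> a \<^bold>\<longleftrightarrow> b \<Longrightarrow> X \<turnstile> b \<^bold>\<longleftrightarrow> c \<Longrightarrow> X \<turnstile> a \<^bold>\<longleftrightarrow> c"
  using replace[of X b c "map_fm Some a \<^bold>\<longleftrightarrow> Atom None"] by (simp add: plug_map_Some)

lemma neg_cong: "X \<turnstile> a \<^bold>\<longleftrightarrow> b \<Longrightarrow> X \<turnstile> \<^bold>\<not> a \<^bold>\<longleftrightarrow> \<^bold>\<not> b"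
  using plug_iff[of X a b "\<^bold>\<not> (Atom None)"] by simp

lemma binary_cong:
  assumes "X \<turnstile> a \<^bold>\<longleftrightarrow> a'" "X \<turnstile> b \<^bold>\<longleftrightarrow> b'"
  shows and_cong: "X \<turnstile> (a \<^bold>\<and> b) \<^bold>\<longleftrightarrow> (a' \<^bold>\<and> b')"
    and or_cong: "X \<turnstile> (a \<^bold>\<or> b) \<^bold>\<longleftrightarrow> (a' \<^bold>\<or> b')"
    and iff_cong: "X \<turnstile> (a \<^bold>\<longleftrightarrow> b) \<^bold>\<longleftrightarrow> (a' \<^bold>\<longleftrightarrow> b')"
    and imp_cong: "X \<turnstile> (a \<^bold>\<longrightarrow> b) \<^bold>\<longleftrightarrow> (a' \<^bold>\<longrightarrow> b')"
proof -
  show "X \<turnstile> (a \<^bold>\<and> b) \<^bold>\<longleftrightarrow> (a' \<^bold>\<and> b')"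
    using plug_iff[OF assms(1), of "Atom None \<^bold>\<and> map_fm Some b"]
      plug_iff[OF assms(2), of "map_fm Some a' \<^bold>\<and> Atom None"]
    by (simp add: plug_map_Some) (rule iff_trans)
  show "X \<turnstile> (a \<^bold>\<or> b) \<^bold>\<longleftrightarrow> (a' \<^bold>\<or> b')"
    using plug_iff[OF assms(1), of "Atom None \<^bold>\<or> map_fm Some b"]
      plug_iff[OF assms(2), of "map_fm Some a' \<^bold>\<or> Atom None"]
    by (simp add: plug_map_Some) (rule iff_trans)
  show "X \<turnstile> (a \<^bold>\<longleftrightarrow> b) \<^bold>\<longleftrightarrow> (a' \<^bold>\<longleftrightarrow> b')"
    using plug_iff[OF assms(1), of "Atom None \<^bold>\<longleftrightarrow> map_fm Some b"]
      plug_iff[OF assms(2), of "map_fm Some a' \<^bold>\<longleftrightarrow> Atom None"]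
    by (simp add: plug_map_Some) (rule iff_trans)
  show "X \<turnstile> (a \<^bold>\<longrightarrow> b) \<^bold>\<longleftrightarrow> (a' \<^bold>\<longrightarrow> b')"
    using plug_iff[OF assms(1), of "Atom None \<^bold>\<longrightarrow> map_fm Some b"]
      plug_iff[OF assms(2), of "map_fm Some a' \<^bold>\<longrightarrow> Atom None"]
    by (simp add: plug_map_Some) (rule iff_trans)
qed

lemma subst_iff: "(\<And>p. p \<in> atoms y \<Longrightarrow> X \<turnstile> \<sigma> p \<^bold>\<longleftrightarrow> \<tau> p) \<Longrightarrow> X \<turnstile> subst \<sigma> y \<^bold>\<longleftrightarrow> subst \<tau> y"
  by (induction y) (simp_all add: iff_refl neg_cong binary_cong)

section \<open>Conjunction and implication\<close>

lemma and_right: "X \<turnstile> a \<^bold>\<and> b \<Longrightarrow> X \<turnstile> b"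
  by (rule and_left[OF iff_mp[OF and_comm]])

text \<open>By the implication axiom, \<open>a\<close> is equivalent to its conjunction with
  \<open>b\<close>, so \<open>a\<close> yields that conjunction and hence its right part.\<close>

lemma imp_mp: "X \<turnstile> a \<^bold>\<longrightarrow> b \<Longrightarrow> X \<turnstile> a \<Longrightarrow> X \<turnstile> b"
  by (rule and_right[OF iff_mp[OF iff_sym[OF iff_mp[OF imp_iff]]]])

lemma imp_intro: "{a} \<turnstile> b \<Longrightarrow> X \<turnstile> a \<^bold>\<longrightarrow> b"
  by (rule from_thm[OF from_cond_proof[OF cond_proof]])

lemma imp_antisym: "X \<turnstile> a \<^bold>\<longrightarrow> b \<Longrightarrow> X \<turnstile> b \<^bold>\<longrightarrow> a \<Longrightarrow> X \<turnstile> a \<^bold>\<longleftrightarrow> b"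
  by (rule iff_trans[OF iff_sym[OF iff_mp[OF imp_iff]]
        iff_trans[OF and_comm iff_mp[OF imp_iff]]])

section \<open>Boolean identities\<close>

lemma top: "X \<turnstile> \<^bold>\<top>"
  by (rule and_right[OF iff_mp[OF iff_sym[OF and_top] iff_refl]])

text \<open>The chain is \<open>a \<and> a\<close>,
  \<open>(a \<and> a) \<or> (a \<and> \<not> a)\<close>, \<open>a \<and> (a \<or> \<not> a)\<close>,
  \<open>a\<close>; the next lemma is its dual.\<close>

lemma and_idem: "X \<turnstile> (a \<^bold>\<and> a) \<^bold>\<longleftrightarrow> a"
proof -
  have "X \<turnstile> (a \<^bold>\<and> a) \<^bold>\<longleftrightarrow> ((a \<^bold>\<and> a) \<^bold>\<or> (a \<^bold>\<and> \<^bold>\<not> a))"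
    by (rule iff_sym[OF iff_trans[OF or_cong[OF iff_refl and_neg] or_bot]])
  moreover have "X \<turnstile> (a \<^bold>\<and> (a \<^bold>\<or> \<^bold>\<not> a)) \<^bold>\<longleftrightarrow> a"
    by (rule iff_trans[OF and_cong[OF iff_refl or_neg] and_top])
  ultimately show ?thesis by (rule iff_trans[OF iff_trans[OF _ iff_sym[OF and_or_distrib]]])
qed

lemma or_idem: "X \<turnstile> (a \<^bold>\<or> a) \<^bold>\<longleftrightarrow> a"
proof -
  have "X \<turnstile> (a \<^bold>\<or> a) \<^bold>\<longleftrightarrow> ((a \<^bold>\<or> a) \<^bold>\<and> (a \<^bold>\<or> \<^bold>\<not> a))"
    by (rule iff_sym[OF iff_trans[OF and_cong[OF iff_refl or_neg] and_top]])
  moreover have "X \<turnstile> (a \<^bold>\<or> (a \<^bold>\<and> \<^bold>\<not> a)) \<^bold>\<longleftrightarrow> a"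
    by (rule iff_trans[OF or_cong[OF iff_refl and_neg] or_bot])
  ultimately show ?thesis by (rule iff_trans[OF iff_trans[OF _ iff_sym[OF or_and_distrib]]])
qed

lemma top_and: "X \<turnstile> (\<^bold>\<top> \<^bold>\<and> a) \<^bold>\<longleftrightarrow> a"
  by (rule iff_trans[OF and_comm and_top])

lemma bot_or: "X \<turnstile> (\<^bold>\<bottom> \<^bold>\<or> a) \<^bold>\<longleftrightarrow> a"
  by (rule iff_trans[OF or_comm or_bot])

text \<open>Writing \<open>\<bottom>\<close> as \<open>a \<and> \<not> a\<close> and reassociating
  lets idempotence absorb the extra \<open>a\<close>.\<close>

lemma and_bot: "X \<turnstile> (a \<^bold>\<and> \<^bold>\<bottom>) \<^bold>\<longleftrightarrow> \<^bold>\<bottom>"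
proof -
  have "X \<turnstile> (a \<^bold>\<and> \<^bold>\<bottom>) \<^bold>\<longleftrightarrow> (a \<^bold>\<and> (a \<^bold>\<and> \<^bold>\<not> a))"
    by (rule and_cong[OF iff_refl iff_sym[OF and_neg]])
  moreover have "X \<turnstile> ((a \<^bold>\<and> a) \<^bold>\<and> \<^bold>\<not> a) \<^bold>\<longleftrightarrow> \<^bold>\<bottom>"
    by (rule iff_trans[OF and_cong[OF and_idem iff_refl] and_neg])
  ultimately show ?thesis by (rule iff_trans[OF iff_trans[OF _ iff_sym[OF and_assoc]]])
qed

lemma bot_and: "X \<turnstile> (\<^bold>\<bottom> \<^bold>\<and> a) \<^bold>\<longleftrightarrow> \<^bold>\<bottom>"
  by (rule iff_trans[OF and_comm and_bot])

lemma bot_imp: "X \<turnstile> \<^bold>\<bottom> \<^bold>\<longrightarrow> a"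
  by (rule iff_mp[OF iff_sym[OF imp_iff] bot_and])

lemma neg_top: "X \<turnstile> \<^bold>\<not> \<^bold>\<top> \<^bold>\<longleftrightarrow> \<^bold>\<bottom>"
  by (rule iff_trans[OF iff_sym[OF top_and] and_neg])

lemma neg_bot: "X \<turnstile> \<^bold>\<not> \<^bold>\<bottom> \<^bold>\<longleftrightarrow> \<^bold>\<top>"
  by (rule iff_trans[OF iff_sym[OF bot_or] or_neg])

text \<open>Conditional proof discharges a sole premise, here \<open>\<top>\<close>, so no side
  premises may enter the proof of \<open>a\<close>. The version with arbitrary premises is
  \<open>iff_topI\<close>.\<close>

lemma theorem_iff_top: "{} \<turnstile> a \<Longrightarrow> X \<turnstile> a \<^bold>\<longleftrightarrow> \<^bold>\<top>"
  by (intro imp_antisym imp_intro top) (rule from_thm)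

lemma refutable_iff_bot: "{a} \<turnstile> \<^bold>\<bottom> \<Longrightarrow> X \<turnstile> a \<^bold>\<longleftrightarrow> \<^bold>\<bottom>"
  by (intro imp_antisym imp_intro bot_imp)

section \<open>Truth tables and atom-free formulas\<close>

abbreviation truth :: "bool \<Rightarrow> 'a fm" where
  "truth b \<equiv> if b then \<^bold>\<top> else \<^bold>\<bottom>"

lemma neg_truth: "X \<turnstile> \<^bold>\<not> (truth p) \<^bold>\<longleftrightarrow> truth (\<not> p)"
  by (simp add: neg_top neg_bot)

lemma and_truth: "X \<turnstile> (truth p \<^bold>\<and> truth q) \<^bold>\<longleftrightarrow> truth (p \<and> q)"
  by (simp add: top_and bot_and)

lemma or_truth: "X \<turnstile> (truth p \<^bold>\<or> truth q) \<^bold>\<longleftrightarrow> truth (p \<or> q)"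
  by (simp add: or_bot bot_or or_idem)

text \<open>Assuming the equivalence carries the theorem \<open>\<top>\<close> over to
  \<open>\<bottom>\<close>, so the equivalence is refutable; likewise for its mirror image.\<close>

lemma top_iff_bot: "X \<turnstile> (\<^bold>\<top> \<^bold>\<longleftrightarrow> \<^bold>\<bottom>) \<^bold>\<longleftrightarrow> \<^bold>\<bottom>"
  by (rule refutable_iff_bot[OF iff_mp[OF _ top]]) (simp add: from_premise)

lemma bot_iff_top: "X \<turnstile> (\<^bold>\<bottom> \<^bold>\<longleftrightarrow> \<^bold>\<top>) \<^bold>\<longleftrightarrow> \<^bold>\<bottom>"
  by (rule refutable_iff_bot[OF iff_mp[OF iff_sym top]]) (simp add: from_premise)

lemma iff_truth: "X \<turnstile> (truth p \<^bold>\<longleftrightarrow> truth q) \<^bold>\<longleftrightarrow> truth (p \<longleftrightarrow> q)"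
  by (simp add: theorem_iff_top[OF iff_refl] top_iff_bot bot_iff_top)

lemma imp_truth: "X \<turnstile> (truth p \<^bold>\<longrightarrow> truth q) \<^bold>\<longleftrightarrow> truth (p \<longrightarrow> q)"
proof -
  \<comment> \<open>The implication axiom reduces this table to those of conjunction and
    equivalence; \<open>eq\<close> matches the resulting truth values.\<close>
  have eq: "((p \<and> q) \<longleftrightarrow> p) \<longleftrightarrow> (p \<longrightarrow> q)" by blast
  have "X \<turnstile> ((truth p \<^bold>\<and> truth q) \<^bold>\<longleftrightarrow> truth p) \<^bold>\<longleftrightarrow> truth ((p \<and> q) \<longleftrightarrow> p)"
    by (rule iff_trans[OF iff_cong[OF and_truth iff_refl] iff_truth])
  then show ?thesis unfolding eq by (rule iff_trans[OF imp_iff])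
qed

lemma closed_iff_truth: "atoms y = {} \<Longrightarrow> X \<turnstile> y \<^bold>\<longleftrightarrow> truth (eval v y)"
proof (induction y)
  case (Neg a)
  show ?case
    unfolding eval.simps by (rule iff_trans[OF neg_cong neg_truth]) (use Neg in auto)
next
  case (And a b)
  show ?case
    unfolding eval.simps by (rule iff_trans[OF and_cong and_truth]) (use And in auto)
next
  case (Or a b)
  show ?case
    unfolding eval.simps by (rule iff_trans[OF or_cong or_truth]) (use Or in auto)
next
  case (Iff a b)
  show ?case
    unfolding eval.simps by (rule iff_trans[OF iff_cong iff_truth]) (use Iff in auto)
next
  case (Imp a b)
  show ?case
    unfolding eval.simps by (rule iff_trans[OF imp_cong imp_truth]) (use Imp in auto)
qed (simp_all add: iff_refl)

text \<open>A formula \<open>c\<close> that yields \<open>b\<close> is equivalent to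
  \<open>b \<and> c\<close>. Distributivity then makes \<open>a \<or> \<not> a\<close> equivalent to
  \<open>b \<and> (a \<or> \<not> a)\<close>, which contains \<open>b\<close>.\<close>

lemma excluded_middle_cases:
  assumes "{a} \<turnstile> b" "{\<^bold>\<not> a} \<turnstile> b"
  shows "X \<turnstile> b"
proof -
  have absorb: "X \<turnstile> c \<^bold>\<longleftrightarrow> (b \<^bold>\<and> c)" if "{c} \<turnstile> b" for c
    by (rule iff_sym[OF iff_trans[OF and_comm iff_mp[OF imp_iff imp_intro[OF that]]]])
  have "X \<turnstile> (a \<^bold>\<or> \<^bold>\<not> a) \<^bold>\<longleftrightarrow> (b \<^bold>\<and> (a \<^bold>\<or> \<^bold>\<not> a))"
    by (rule iff_trans[OF or_cong[OF absorb[OF assms(1)] absorb[OF assms(2)]]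
          iff_sym[OF and_or_distrib]])
  moreover have "X \<turnstile> a \<^bold>\<or> \<^bold>\<not> a" by (rule iff_mp[OF iff_sym[OF or_neg] top])
  ultimately show ?thesis by (rule and_left[OF iff_mp])
qed

end


section \<open>Completeness\<close>

locale IRL_extension_disj_to_imp = IRL_extension +
  assumes disj_to_imp: "instances disj_to_imp \<subseteq> axioms S"
begin

lemma disj_imp: "X \<turnstile> (\<^bold>\<not> a \<^bold>\<or> b) \<^bold>\<longrightarrow> (a \<^bold>\<longrightarrow> b)"
proof -
  \<comment> \<open>The schema has only the letters \<open>LPhi\<close> and \<open>LPsi\<close>, so
    \<open>LChi\<close> receives a dummy value.\<close>
  have "subst (case_letter a b undefined) Defs.disj_to_imp \<in> axioms S"
    using disj_to_imp unfolding instances_def by blast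
  then show ?thesis by (intro from_thm[OF from_axiom]) (simp add: disj_to_imp_def)
qed

text \<open>The added schema is used through modus ponens, which keeps the premises
  \<open>X\<close>.\<close>

lemma iff_topI:
  assumes "X \<turnstile> a"
  shows "X \<turnstile> a \<^bold>\<longleftrightarrow> \<^bold>\<top>"
proof -
  have "X \<turnstile> (\<^bold>\<not> \<^bold>\<top> \<^bold>\<or> a) \<^bold>\<longleftrightarrow> a"
    by (rule iff_trans[OF or_cong[OF neg_top iff_refl] bot_or])
  then have "X \<turnstile> \<^bold>\<top> \<^bold>\<longrightarrow> a"
    by (rule imp_mp[OF disj_imp iff_mp[OF iff_sym assms]])
  then show ?thesis
    by (rule iff_trans[OF iff_sym[OF top_and] iff_mp[OF imp_iff]])
qed

lemma iff_botI:
  assumes "X \<turnstile> \<^bold>\<not> a"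
  shows "X \<turnstile> a \<^bold>\<longleftrightarrow> \<^bold>\<bottom>"
proof -
  have "X \<turnstile> a \<^bold>\<longleftrightarrow> (a \<^bold>\<and> \<^bold>\<not> a)"
    by (rule iff_sym[OF iff_trans[OF and_cong[OF iff_refl iff_topI[OF assms]] and_top]])
  then show ?thesis by (rule iff_trans[OF _ and_neg])
qed

text \<open>Atoms other than \<open>p\<close> are left in place, so their equivalences are
  reflexivity and \<open>subst_iff\<close> covers the whole formula.\<close>

lemma derivable_if_instance_theorem:
  assumes "X \<turnstile> Atom p \<^bold>\<longleftrightarrow> c" "{} \<turnstile> subst (Atom(p := c)) y"
  shows "X \<turnstile> y"
proof -
  have "X \<turnstile> subst Atom y \<^bold>\<longleftrightarrow> subst (Atom(p := c)) y"
    by (rule subst_iff) (simp add: assms(1) iff_refl)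
  then show ?thesis
    unfolding subst_Atom by (rule iff_mp[OF iff_sym from_thm[OF assms(2)]])
qed

lemma tautology_theorem:
  assumes "finite A" "atoms y \<subseteq> A" "entails {} y"
  shows "{} \<turnstile> y"
  using assms
proof (induction A arbitrary: y rule: finite_induct)
  case empty
  then have "{} \<turnstile> y \<^bold>\<longleftrightarrow> \<^bold>\<top>"
    using closed_iff_truth[of y "{}" undefined] by (simp add: entails_def)
  then show ?case by (rule iff_mp[OF iff_sym top])
next
  case (insert p A)
  \<comment> \<open>An atom-free \<open>c\<close> removes \<open>p\<close> from the formula, and a
    substitution instance of a tautology is a tautology.\<close>
  have inst: "{} \<turnstile> subst (Atom(p := c)) y" if "atoms c = {}" for c
    using that insert.prems
    by (intro insert.IH) (auto simp: atoms_subst eval_subst entails_def split: if_splits)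
  show ?case
  proof (rule excluded_middle_cases)
    show "{Atom p} \<turnstile> y"
      by (rule derivable_if_instance_theorem[OF iff_topI inst]) (simp_all add: from_premise)
    show "{\<^bold>\<not> (Atom p)} \<turnstile> y"
      by (rule derivable_if_instance_theorem[OF iff_botI inst]) (simp_all add: from_premise)
  qed
qed

text \<open>Each premise moves into an implication on the semantic side, where this is sound for any
  number of premises; modus ponens then recovers it from \<open>X\<close>.\<close>

lemma complete:
  assumes "finite Y" "Y \<subseteq> X" "entails Y y"
  shows "X \<turnstile> y"
  using assms
proof (induction Y arbitrary: y rule: finite_induct)
  case empty
  then show ?case by (intro from_thm[OF tautology_theorem[OF finite_atoms subset_refl]])
next
  case (insert x Y)
  then have "X \<turnstile> x \<^bold>\<longrightarrow> y" by (auto simp: entails_def)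
  then show ?case by (rule imp_mp) (use insert.prems in \<open>simp add: from_premise\<close>)
qed

end


section \<open>Deductive equivalence\<close>

lemma subst_entailed: "entails {} s \<Longrightarrow> entails {} (subst \<sigma> s)"
  by (simp add: entails_def eval_subst)

lemma IRL_schemas_valid: "s \<in> IRL_schemas \<Longrightarrow> entails {} s"
  unfolding IRL_schemas_def entails_def by auto

lemma disj_to_imp_valid: "entails {} disj_to_imp"
  by (simp add: disj_to_imp_def entails_def)

lemma eval_plug_cong:
  assumes "eval v a \<longleftrightarrow> eval v b"
  shows "eval v (plug a t) \<longleftrightarrow> eval v (plug b t)"
proof -
  \<comment> \<open>By \<open>eval_subst\<close>, plugging is evaluation of the template with the
    mark valued as the plugged formula; \<open>a\<close> and \<open>b\<close> give the same
    valuation.\<close>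
  have "(\<lambda>p. eval v (case_option a Atom p)) = (\<lambda>p. eval v (case_option b Atom p))"
    using assms by (auto split: option.split)
  then show ?thesis by (simp add: plug_def eval_subst)
qed

lemma IRL_rules_sound:
  assumes "(ps, c) \<in> rules IRL"
  shows "entails (set ps) c"
proof -
  consider "(ps, c) \<in> R1 \<union> R2" | "(ps, c) \<in> R3"
    using assms by (auto simp: IRL_def)
  then show ?thesis
  proof cases
    case 1
    then show ?thesis by (auto simp: R1_def R2_def entails_def)
  next
    case 2
    then obtain a b t where "ps = [a \<^bold>\<longleftrightarrow> b, plug a t]" "c = plug b t"
      unfolding R3_def by blast
    then show ?thesis using eval_plug_cong by (simp add: entails_def) blast
  qed
qed

theorem mainTheorem1:
  fixes CL :: "'a::countable system"
  assumes "axiomatizes_CL CL"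
  shows "deductively_equivalent (add_schemas IRL {disj_to_imp}) CL"
proof -
  let ?S = "add_schemas IRL {disj_to_imp} :: 'a system"
  interpret IRL_extension_disj_to_imp ?S
    by standard (auto simp: add_schemas_def IRL_def)
  have CL: "derivable CL X y \<longleftrightarrow> entails X y" if "finite X" for X y
    using assms that unfolding axiomatizes_CL_def by blast
  have "derives_system ?S CL"
    unfolding derives_system_def
  proof (intro conjI ballI impI allI)
    fix a assume "a \<in> axioms CL"
    then have "entails {} a" using CL from_axiom by blast
    then show "derivable ?S {} a" using complete by blast
  next
    fix r assume r: "r \<in> rules CL"
    have "derivable ?S (set ps) c" if "r = (ps, c)" for ps c
    proof (rule complete[OF finite_set subset_refl])
      \<comment> \<open>A rule instance is derivable from its own finitely many premises, hence
        truth-preserving.\<close>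
      have "derivable CL (set ps) c"
        using r that by (blast intro: from_rule from_premise)
      then show "entails (set ps) c" by (simp add: CL)
    qed
    then show "case r of (ps, c) \<Rightarrow> derivable ?S (set ps) c" by (simp split: prod.split)
  next
    fix a b assume "derivable ?S {a} b"
    then show "derivable ?S {} (a \<^bold>\<longrightarrow> b)" by (rule imp_intro)
  qed
  moreover have "derives_system CL ?S"
    unfolding derives_system_def
  proof (intro conjI ballI impI allI)
    fix a assume "a \<in> axioms ?S"
    then have "entails {} a"
      by (auto simp: add_schemas_def IRL_def instances_def
          intro: subst_entailed IRL_schemas_valid disj_to_imp_valid)
    then show "derivable CL {} a" by (simp add: CL)
  next
    fix r assume "r \<in> rules ?S"
    then have "r \<in> rules IRL" by (simp add: add_schemas_def)
    then show "case r of (ps, c) \<Rightarrow> derivable CL (set ps) c"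
      by (auto simp: CL intro: IRL_rules_sound)
  next
    \<comment> \<open>Closure of \<open>CL\<close> under conditional proof comes from the semantic
      deduction property.\<close>
    fix a b assume "derivable CL {a} b"
    then show "derivable CL {} (a \<^bold>\<longrightarrow> b)" by (simp add: CL entails_def)
  qed
  ultimately show ?thesis unfolding deductively_equivalent_def ..
qed

end
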